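(* Let $q\in(0,1)$, $\alpha,\beta>-1$, $n\in\mathbb N$, and let $f:(0,1)\to\mathbb R$ be a function satisfying condition $C(\alpha)$. 1. If $f$ is increasing (respectively decreasing), then the function $M_{n,q}^{\alpha,\beta}f$ is increasing (respectively decreasing) on $[0,1]$. 2. If $f$ is convex, then the function $M_{n,q}^{\alpha,\beta}f$ is convex on $[0,1]$.
   Context: Increasing and decreasing are understood in the weak (non-strict) sense. For real $a$, $[a]_q=\frac{1-q^a}{1-q}$; $[n]_q!=\prod_{j=1}^n[j]_q$; $\begin{bmatrix}n\\k\end{bmatrix}_q=\frac{[n]_q!}{[k]_q!\,[n-k]_q!}$. For real $a$, $(1-x)_q^a=\prod_{j=0}^\infty\frac{1-q^jx}{1-q^{j+a}x}$. The Jackson integral is $\int_0^ah(t)\,d_qt=a(1-q)\sum_{i\ge0}q^ih(q^ia)$. Put $b_{n,k,q}(x)=\begin{bmatrix}n\\k\end{bmatrix}_qx^k(1-x)_q^{n-k}$, $0\le k\le n$. For $f:(0,1)\to\mathbb R$, $$M_{n,q}^{\alpha,\beta}f(x)=\sum_{k=0}^n f_{n,k,q}^{\alpha,\beta}\,b_{n,k,q}(x),\qquad f_{n,k,q}^{\alpha,\beta}=\frac{\int_0^1t^{k+\alpha}(1-qt)_q^{n-k+\beta}f(q^{\beta+1}t)\,d_qt}{\int_0^1t^{k+\alpha}(1-qt)_q^{n-k+\beta}\,d_qt}.$$ Condition $C(\alpha)$: there exist $\gamma\ge0$ with $\alpha>\gamma-1$ and $A\in(0,1]$ such that $x^\gamma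 f(x)$ is bounded on $(0,A]$ (for $A=1$, on $(0,1)$). Under this condition $M_{n,q}^{\alpha,\beta}f$ is well defined. *)

theory Defs
  imports "HOL-Analysis.Analysis"
begin

definition q_bracket :: "real \<Rightarrow> real \<Rightarrow> real" where
  "q_bracket q a = (1 - q powr a) / (1 - q)"

definition q_fact :: "real \<Rightarrow> nat \<Rightarrow> real" where
  "q_fact q n = (\<Prod>j=1..n. q_bracket q (real j))"

definition q_binomial :: "real \<Rightarrow> nat \<Rightarrow> nat \<Rightarrow> real" where
  "q_binomial q n k = q_fact q n / (q_fact q k * q_fact q (n - k))"

text \<open>
  \<^term>\<open>q_pow q x a\<close> stands for $(1-x)_q^a$. For $a = 0$ every factor of the infinite product
  is identically 1; this case is split off only because at $x = 1$ the factor $j = 0$ reads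
  $0/0$, which HOL evaluates to 0.
\<close>

definition q_pow :: "real \<Rightarrow> real \<Rightarrow> real \<Rightarrow> real" where
  "q_pow q x a =
     (if a = 0 then 1 else (\<Prod>j. (1 - q ^ j * x) / (1 - q powr (real j + a) * x)))"

definition jackson_integral :: "real \<Rightarrow> real \<Rightarrow> (real \<Rightarrow> real) \<Rightarrow> real" where
  "jackson_integral q a h = a * (1 - q) * (\<Sum>i. q ^ i * h (q ^ i * a))"

definition q_bernstein :: "real \<Rightarrow> nat \<Rightarrow> nat \<Rightarrow> real \<Rightarrow> real" where
  "q_bernstein q n k x = q_binomial q n k * x ^ k * q_pow q x (real n - real k)"

text \<open>
  The functions $f : (0,1) \to {\bf R}$ are total functions here; the definitions below
  only inspect their values on the open unit interval (for $0 < q < 1$ and $\beta > -1$).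
\<close>

definition q_durrmeyer_coeff ::
    "real \<Rightarrow> real \<Rightarrow> real \<Rightarrow> nat \<Rightarrow> nat \<Rightarrow> (real \<Rightarrow> real) \<Rightarrow> real" where
  "q_durrmeyer_coeff q \<alpha> \<beta> n k f =
     jackson_integral q 1 (\<lambda>t. t powr (real k + \<alpha>) * q_pow q (q * t) (real n - real k + \<beta>)
                                 * f (q powr (\<beta> + 1) * t)) /
     jackson_integral q 1 (\<lambda>t. t powr (real k + \<alpha>) * q_pow q (q * t) (real n - real k + \<beta>))"

definition q_durrmeyer ::
    "real \<Rightarrow> real \<Rightarrow> real \<Rightarrow> nat \<Rightarrow> (real \<Rightarrow> real) \<Rightarrow> real \<Rightarrow> real" where
  "q_durrmeyer q \<alpha> \<beta> n f x =
     (\<Sum>k=0..n. q_durrmeyer_coeff q \<alpha> \<beta> n k f * q_bernstein q n k x)"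

definition condition_C :: "real \<Rightarrow> (real \<Rightarrow> real) \<Rightarrow> bool" where
  "condition_C \<alpha> f \<longleftrightarrow>
     (\<exists>\<gamma>\<ge>0. \<alpha> > \<gamma> - 1 \<and>
       (\<exists>A\<in>{0<..1}. bounded ((\<lambda>x. x powr \<gamma> * f x) ` ({0<..A} \<inter> {0<..<1}))))"

end

theory Submission
  imports Defs
begin

text \<open>
  The operator splits into two steps, $f \mapsto (c_k)_{k \le n}$ with $c_k$ the Durrmeyer
  coefficients, and $(c_k) \mapsto \sum_k c_k\, b_{n,k,q}$. Each step carries monotonicity to
  monotonicity and convexity to convexity, where a sequence $c$ counts as convex if
  $(c_{k+1} - c_k)/q^k$ increases, that is, if it is convex as a function of $1 - q^k$.

  First step. The coefficient $c_k$ is the mean of $g_i = f(q^{\beta+1} q^i)$ under the $q$-beta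
  weights $w_{a,b}(i) = q^{ai} (1 - q^{i+1})_q^{b-1}$ with $a = k + \alpha + 1$ and
  $b = n - k + \beta + 1$. Write $E_{a,b}$ for that mean and
  $(\partial g)_i = (g_i - g_{i+1})/q^i$ for the $q$-difference quotient. Summation by parts gives
  \[ E_{a+1,b}[g] - E_{a,b+1}[g] = \frac{q^a}{1 - q^{a+b+1}}\, E_{a+1,b+1}[\partial g] \]
  (\<open>beta_mean_step\<close>). Hence $(c_{k+1} - c_k)/q^k$ is a constant times a mean of $\partial g$,
  and these means belong to the same family with $\alpha$ raised by one. If $f$ increases then
  $\partial g \ge 0$ and $c$ increases; if $f$ is convex then $\partial\partial g \ge 0$, and
  the identity applied to $\partial g$ shows that $c$ is convex.

  Second step. If $x < z$ and $b_{n,k,q}(x) \le b_{n,k,q}(z)$ for some $k$, then the same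
  inequality holds for all larger indices (\<open>bernstein_monomial_le_mono\<close>). So
  $b_{n,k,q}(x) - b_{n,k,q}(z)$ changes sign at most once in $k$; its sum over $k$ vanishes, and
  pairing it with an increasing $c$ gives a nonpositive number. For convexity take
  $y = (1-t) x + t z$ and $v_k = (1-t)\, b_{n,k,q}(x) + t\, b_{n,k,q}(z) - b_{n,k,q}(y)$. The
  increments of $v_k / b_{n,k,q}(y)$ in $k$ have the sign of the difference at $z$ and $x$ of a
  basis function of degree $n - 1$, so by the same comparison $v$ has the sign pattern
  $+, -, +$. As the moments of $v$ against $1$ and $q^k$ vanish, Abel summation reduces the
  pairing with a convex $c$ to the case of one sign change.
\<close>

section \<open>Pairing sequences with sign changes\<close>

text \<open>
  Since the weights sum to zero, a constant may be subtracted from \<open>e\<close>. Taking its value at the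
  first negative weight makes every summand nonpositive.
\<close>

lemma single_crossing_sum_nonpos:
  fixes e w :: "nat \<Rightarrow> real"
  assumes zero: "(\<Sum>j<N. w j) = 0"
    and crossing: "\<And>i j. j \<le> i \<Longrightarrow> i < N \<Longrightarrow> w j < 0 \<Longrightarrow> w i \<le> 0"
    and mono: "\<And>i j. j \<le> i \<Longrightarrow> i < N \<Longrightarrow> e j \<le> e i"
  shows "(\<Sum>j<N. e j * w j) \<le> 0"
proof (cases "\<exists>j<N. w j < 0")
  case True
  define p where "p = (LEAST j. j < N \<and> w j < 0)"
  have p: "p < N" "w p < 0"
    using LeastI_ex[of "\<lambda>j. j < N \<and> w j < 0"] True unfolding p_def by auto
  have before: "w j \<ge> 0" if "j < p" for j
    using not_less_Least[of j "\<lambda>j. j < N \<and> w j < 0"] that p(1) unfolding p_def by force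
  have "(e j - e p) * w j \<le> 0" if "j < N" for j
  proof (cases "j < p")
    case True
    then show ?thesis
      using before[of j] mono[of j p] p(1) by (intro mult_nonpos_nonneg) auto
  next
    case False
    then show ?thesis
      using crossing[of p j] mono[of p j] p that by (intro mult_nonneg_nonpos) auto
  qed
  then have "(\<Sum>j<N. (e j - e p) * w j) \<le> 0"
    by (intro sum_nonpos) auto
  then show ?thesis
  proof -
    have "(\<Sum>j<N. (e j - e p) * w j) = (\<Sum>j<N. e j * w j) - e p * (\<Sum>j<N. w j)"
      by (simp only: left_diff_distrib sum_subtractf sum_distrib_left)
    then show ?thesis
      using \<open>(\<Sum>j<N. (e j - e p) * w j) \<le> 0\<close> zero by simp
  qed
next
  case False
  then have "w j = 0" if "j < N" for j
  proof -
    have "w i \<ge> 0" if "i \<in> {..<N}" for i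
      using False that by force
    then show ?thesis
      using sum_nonneg_eq_0_iff[of "{..<N}" w] zero that by simp
  qed
  then show ?thesis by simp
qed

lemma sum_by_parts:
  fixes c v :: "nat \<Rightarrow> real"
  shows "(\<Sum>k\<le>n. c k * v k) = c n * (\<Sum>k\<le>n. v k) - (\<Sum>j<n. (c (Suc j) - c j) * (\<Sum>k\<le>j. v k))"
  by (induction n) (simp_all add: algebra_simps)

text \<open>
  The sign hypothesis says that \<open>v\<close> is nonnegative, then nonpositive, then nonnegative. The
  partial sums of such a sequence with total zero change sign only once, from plus to minus.
  Summation by parts pairs these partial sums, weighted by the increments of \<open>u\<close>, with the
  divided differences of \<open>c\<close>, which increase; the moment condition makes the weighted partial
  sums add up to zero, so the single crossing lemma applies.
\<close>

lemma convex_sequence_sum_nonneg: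
  fixes c u v :: "nat \<Rightarrow> real"
  assumes zero: "(\<Sum>k\<le>n. v k) = 0" and moment: "(\<Sum>k\<le>n. u k * v k) = 0"
    and signs: "\<And>i k l. i < k \<Longrightarrow> k \<le> l \<Longrightarrow> l \<le> n \<Longrightarrow> v i < 0 \<Longrightarrow> v k > 0 \<Longrightarrow> v l \<ge> 0"
    and u: "\<And>j. j < n \<Longrightarrow> u j < u (Suc j)"
    and convex: "\<And>i j. j \<le> i \<Longrightarrow> i < n \<Longrightarrow>
      (c (Suc j) - c j) / (u (Suc j) - u j) \<le> (c (Suc i) - c i) / (u (Suc i) - u i)"
  shows "(\<Sum>k\<le>n. c k * v k) \<ge> 0"
proof -
  define V where "V = (\<lambda>j. \<Sum>k\<le>j. v k)"
  define w where "w = (\<lambda>j. (u (Suc j) - u j) * V j)"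
  have u_diff: "u (Suc j) - u j \<noteq> 0" if "j < n" for j
    using u[OF that] by simp
  \<comment> \<open>A negative partial sum has met a negative term. If a later one were positive, a positive term
    would have followed, so all remaining terms would be nonnegative and the total positive.\<close>
  have V_cross: "V i \<le> 0" if "j \<le> i" "i < n" "V j < 0" for i j
  proof (rule ccontr)
    assume "\<not> V i \<le> 0"
    have "\<exists>a\<le>j. v a < 0"
      using \<open>V j < 0\<close> sum_nonneg[of "{..j}" v] unfolding V_def by force
    then obtain a where a: "a \<le> j" "v a < 0" by blast
    have split: "V m = V l + (\<Sum>k\<in>{l<..m}. v k)" if "l \<le> m" for l m
      using that sum.union_disjoint[of "{..l}" "{l<..m}" v] ivl_disj_un(9)[of l m]
      by (auto simp: V_def ivl_disj_un ivl_disj_int)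
    have "(\<Sum>k\<in>{j<..i}. v k) > 0"
      using split[of j i] that \<open>\<not> V i \<le> 0\<close> by simp
    then obtain b where b: "j < b" "b \<le> i" "v b > 0"
      using sum_nonpos[of "{j<..i}" v] by force
    have "(\<Sum>k\<in>{i<..n}. v k) \<ge> 0"
      using signs[of a b] a b by (intro sum_nonneg) auto
    then show False
      using split[of i n] zero that \<open>\<not> V i \<le> 0\<close> by (simp add: V_def)
  qed
  have parts: "(\<Sum>k\<le>n. d k * v k) = - (\<Sum>j<n. ((d (Suc j) - d j) / (u (Suc j) - u j)) * w j)" for d
  proof -
    have "(\<Sum>j<n. (d (Suc j) - d j) * V j) = (\<Sum>j<n. ((d (Suc j) - d j) / (u (Suc j) - u j)) * w j)"
      using u_diff by (intro sum.cong) (simp_all add: w_def)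
    then show ?thesis
      using sum_by_parts[of d v n] zero by (simp add: V_def)
  qed
  have "(\<Sum>j<n. ((u (Suc j) - u j) / (u (Suc j) - u j)) * w j) = (\<Sum>j<n. w j)"
    using u_diff by (intro sum.cong) simp_all
  then have "(\<Sum>j<n. w j) = 0"
    using parts[of u] moment by simp
  moreover have "w i \<le> 0" if "j \<le> i" "i < n" "w j < 0" for i j
    using V_cross[of j i] u[of i] u[of j] that
    by (auto simp: w_def mult_less_0_iff intro!: mult_nonneg_nonpos)
  ultimately have "(\<Sum>j<n. ((c (Suc j) - c j) / (u (Suc j) - u j)) * w j) \<le> 0"
    using convex by (intro single_crossing_sum_nonpos) auto
  then show ?thesis
    using parts[of c] by simp
qed

section \<open>The q-power\<close>

locale q_parameter =
  fixes q :: real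
  assumes q_pos: "0 < q" and q_less_1: "q < 1"
begin

lemma q_powr_less_1: "q powr a < 1" if "a > 0"
  using powr_less_mono2[of a q 1] that q_pos q_less_1 by simp

lemma q_powr_real: "q powr real i = q ^ i"
  using q_pos by (simp add: powr_realpow)

lemma q_pow_convergent:
  assumes "0 \<le> x" "q powr a * x < 1"
  shows "convergent_prod (\<lambda>j. (1 - q ^ j * x) / (1 - q powr (real j + a) * x))"
proof -
  have small: "q powr (real j + a) * x \<le> q powr a * x" for j
  proof -
    have "q powr (real j + a) = q ^ j * q powr a"
      by (simp add: powr_add q_powr_real)
    also have "\<dots> \<le> q powr a"
      using q_pos q_less_1 by (simp add: mult_left_le_one_le power_le_one)
    finally show ?thesis
      using assms(1) by (rule mult_right_mono)
  qed
  have "summable (\<lambda>j. norm ((1 - q ^ j * x) / (1 - q powr (real j + a) * x) - 1))"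
  proof (rule summable_comparison_test')
    show "summable (\<lambda>j. (\<bar>q powr a - 1\<bar> * x / (1 - q powr a * x)) * q ^ j)"
      using q_pos q_less_1 by (intro summable_mult summable_geometric) auto
  next
    fix j :: nat
    have pos: "0 < 1 - q powr a * x" "1 - q powr a * x \<le> 1 - q powr (real j + a) * x"
      using assms(2) small[of j] by auto
    have "(1 - q ^ j * x) / (1 - q powr (real j + a) * x) - 1
        = (q powr a - 1) * x * q ^ j / (1 - q powr (real j + a) * x)"
      using pos by (simp add: field_simps powr_add q_powr_real)
    then have "norm ((1 - q ^ j * x) / (1 - q powr (real j + a) * x) - 1)
        = \<bar>q powr a - 1\<bar> * x * q ^ j / (1 - q powr (real j + a) * x)"
      using pos assms(1) q_pos by (simp add: abs_mult)
    also have "\<dots> \<le> \<bar>q powr a - 1\<bar> * x * q ^ j / (1 - q powr a * x)"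
      using pos assms(1) q_pos by (intro divide_left_mono mult_nonneg_nonneg mult_pos_pos) auto
    finally show "norm (norm ((1 - q ^ j * x) / (1 - q powr (real j + a) * x) - 1))
        \<le> (\<bar>q powr a - 1\<bar> * x / (1 - q powr a * x)) * q ^ j"
      by simp
  qed
  then show ?thesis
    by (intro abs_convergent_prod_imp_convergent_prod summable_imp_abs_convergent_prod)
qed

text \<open>
  At $x = 1$, $a = 0$ the first factor is $0/0$, hence the last hypothesis.
\<close>

lemma q_pow_LIMSEQ:
  assumes "0 \<le> x" "q powr a * x < 1" "x < 1 \<or> a \<noteq> 0"
  shows "(\<lambda>n. \<Prod>j\<le>n. (1 - q ^ j * x) / (1 - q powr (real j + a) * x)) \<longlonglongrightarrow> q_pow q x a"
proof (cases "a = 0")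
  case True
  have "q ^ j * x < 1" for j
  proof -
    have "q ^ j * x \<le> 1 * x"
      using q_pos q_less_1 assms(1) by (intro mult_right_mono power_le_one) auto
    then show ?thesis
      using assms(3) True by simp
  qed
  then have "(1 - q ^ j * x) / (1 - q powr (real j + a) * x) = 1" for j
    using True by (simp add: q_powr_real less_imp_neq)
  then show ?thesis
    by (simp only: prod.neutral_const) (simp add: True q_pow_def)
next
  case False
  then show ?thesis
    using convergent_prod_LIMSEQ[OF q_pow_convergent[OF assms(1,2)]] by (simp add: q_pow_def)
qed

lemma q_pow_of_nat:
  assumes "0 \<le> x" "x \<le> 1"
  shows "q_pow q x (real m) = (\<Prod>j<m. 1 - q ^ j * x)"
proof (cases "m = 0")
  case True
  then show ?thesis by (simp add: q_pow_def)
next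
  case False
  have less: "q ^ i * x < 1" if "i > 0" for i
  proof -
    have "q ^ i < 1"
      using q_pos q_less_1 that by (simp add: power_less_one_iff)
    moreover have "q ^ i * x \<le> q ^ i * 1"
      using assms q_pos by (intro mult_left_mono) auto
    ultimately show ?thesis by simp
  qed
  \<comment> \<open>All but the first m numerators and the last m denominators cancel.\<close>
  have partial: "(\<Prod>j\<le>n. (1 - q ^ j * x) / (1 - q powr (real j + real m) * x))
      = (\<Prod>j<m. 1 - q ^ j * x) / (\<Prod>j<m. 1 - q ^ (n + 1 + j) * x)" for n
  proof -
    have "(\<Prod>j\<le>n. 1 - q ^ j * x) * (\<Prod>j<m. 1 - q ^ (n + 1 + j) * x) = (\<Prod>j<n + 1 + m. 1 - q ^ j * x)"
      using prod.atLeastLessThan_concat[of 0 "n + 1" "n + 1 + m" "\<lambda>j. 1 - q ^ j * x"]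
        prod.shift_bounds_nat_ivl[of "\<lambda>j. 1 - q ^ j * x" 0 "n + 1" m]
      by (simp add: atLeast0LessThan lessThan_Suc_atMost add_ac)
    moreover have "(\<Prod>j<m. 1 - q ^ j * x) * (\<Prod>j\<le>n. 1 - q ^ (j + m) * x) = (\<Prod>j<n + 1 + m. 1 - q ^ j * x)"
      using prod.atLeastLessThan_concat[of 0 m "n + 1 + m" "\<lambda>j. 1 - q ^ j * x"]
        prod.shift_bounds_nat_ivl[of "\<lambda>j. 1 - q ^ j * x" 0 m "n + 1"]
      by (simp add: atLeast0LessThan lessThan_Suc_atMost add_ac)
    moreover have "(\<Prod>j<m. 1 - q ^ (n + 1 + j) * x) \<noteq> 0" "(\<Prod>j\<le>n. 1 - q ^ (j + m) * x) \<noteq> 0"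
    proof -
      have "1 - q ^ i * x \<noteq> 0" if "i > 0" for i
        using less[OF that] by simp
      then show "(\<Prod>j<m. 1 - q ^ (n + 1 + j) * x) \<noteq> 0" "(\<Prod>j\<le>n. 1 - q ^ (j + m) * x) \<noteq> 0"
        using False by (simp_all only: prod_zero_iff finite_lessThan finite_atMost) auto
    qed
    moreover have "q powr (real j + real m) = q ^ (j + m)" for j
      by (metis of_nat_add q_powr_real)
    ultimately show ?thesis
      by (simp add: prod_dividef frac_eq_eq)
  qed
  have "(\<lambda>n. q ^ (n + 1 + j)) \<longlonglongrightarrow> 0" for j
    using LIMSEQ_ignore_initial_segment[OF LIMSEQ_realpow_zero[of q], of "1 + j"] q_pos q_less_1
    by (simp add: add_ac)
  then have "(\<lambda>n. (\<Prod>j<m. 1 - q ^ j * x) / (\<Prod>j<m. 1 - q ^ (n + 1 + j) * x))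
      \<longlonglongrightarrow> (\<Prod>j<m. 1 - q ^ j * x) / (\<Prod>j<m. 1 - 0 * x)"
    by (intro tendsto_intros) auto
  then have "(\<lambda>n. \<Prod>j\<le>n. (1 - q ^ j * x) / (1 - q powr (real j + real m) * x))
      \<longlonglongrightarrow> (\<Prod>j<m. 1 - q ^ j * x)"
    unfolding partial by simp
  moreover have "q powr real m * x < 1"
    using less False by (simp add: q_powr_real)
  ultimately show ?thesis
    using q_pow_LIMSEQ[OF assms(1), of "real m"] False LIMSEQ_unique by auto
qed

section \<open>Means with respect to q-beta weights\<close>

text \<open>
  The mass of the $q$-beta measure at $q^i$: the integrand $t^{a-1} (1-qt)_q^{b-1}$ at $t = q^i$
  times the factor $q^i$ of the Jackson integral.
\<close>

definition beta_weight :: "real \<Rightarrow> real \<Rightarrow> nat \<Rightarrow> real" where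
  "beta_weight a b i = q powr (a * real i) * q_pow q (q * q ^ i) (b - 1)"

lemma q_powr_shift_less_1: "q powr (b - 1) * (q * q ^ i) < 1" if "b > 0"
proof -
  have "q powr (b - 1) * (q * q ^ i) = q powr (b + real i)"
    using q_pos by (simp add: powr_add powr_diff q_powr_real)
  then show ?thesis
    using that q_powr_less_1[of "b + real i"] by simp
qed

lemma q_Suc_less_1: "q * q ^ i < 1"
  using power_Suc_less_one[OF q_pos q_less_1, of i] by simp

lemma beta_weight_pos:
  assumes "b > 0"
  shows "beta_weight a b i > 0"
proof -
  have "q_pow q (q * q ^ i) (b - 1) > 0"
  proof (cases "b = 1")
    case False
    have "(1 - q ^ j * (q * q ^ i)) / (1 - q powr (real j + (b - 1)) * (q * q ^ i)) > 0" for j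
    proof -
      have "q ^ j * (q * q ^ i) < 1"
        using q_Suc_less_1[of "j + i"] by (simp add: power_add mult_ac)
      moreover have "q powr (real j + (b - 1)) * (q * q ^ i) < 1"
        using q_powr_shift_less_1[OF assms, of "j + i"]
        by (simp add: power_add powr_add q_powr_real mult_ac)
      ultimately show ?thesis by simp
    qed
    then show ?thesis
      using False q_pos less_0_prodinf[OF q_pow_convergent[of "q * q ^ i" "b - 1"]]
        q_powr_shift_less_1[OF assms] by (simp add: q_pow_def)
  qed (simp add: q_pow_def)
  then show ?thesis
    using q_pos by (simp add: beta_weight_def)
qed

text \<open>
  Moving from $x$ to $qx$ removes the first factor of the product that defines $(1-x)_q^{b-1}$.
\<close>

lemma beta_weight_Suc:
  assumes "b > 0"
  shows "(1 - q ^ Suc i) * beta_weight a b (Suc i)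
       = q powr a * (1 - q powr b * q ^ i) * beta_weight a b i"
proof -
  define x where "x = q * q ^ i"
  define F where "F = (\<lambda>y j. (1 - q ^ j * y) / (1 - q powr (real j + (b - 1)) * y))"
  have x: "0 \<le> x" "x < 1" "q powr (b - 1) * x < 1"
    using q_pos q_Suc_less_1 q_powr_shift_less_1[OF assms] by (auto simp: x_def)
  have qx: "0 \<le> q * x" "q * x < 1" "q powr (b - 1) * (q * x) < 1"
    using q_pos q_Suc_less_1[of "Suc i"] q_powr_shift_less_1[OF assms, of "Suc i"]
    by (auto simp: x_def)
  have "(\<lambda>n. \<Prod>j\<le>n. F x j) \<longlonglongrightarrow> q_pow q x (b - 1)"
    unfolding F_def using x by (intro q_pow_LIMSEQ) auto
  then have "(\<lambda>n. \<Prod>j\<le>Suc n. F x j) \<longlonglongrightarrow> q_pow q x (b - 1)"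
    by (rule LIMSEQ_Suc)
  moreover have "(\<Prod>j\<le>Suc n. F x j) = F x 0 * (\<Prod>j\<le>n. F (q * x) j)" for n
  proof -
    have "F x (Suc j) = F (q * x) j" for j
      using q_pos by (simp add: F_def powr_add mult_ac q_powr_real)
    then show ?thesis
      by (simp only: prod.atMost_Suc_shift)
  qed
  ultimately have "(\<lambda>n. F x 0 * (\<Prod>j\<le>n. F (q * x) j)) \<longlonglongrightarrow> q_pow q x (b - 1)"
    by simp
  moreover have "(\<lambda>n. F x 0 * (\<Prod>j\<le>n. F (q * x) j)) \<longlonglongrightarrow> F x 0 * q_pow q (q * x) (b - 1)"
    unfolding F_def using qx by (intro tendsto_mult tendsto_const q_pow_LIMSEQ) auto
  ultimately have "q_pow q x (b - 1) = F x 0 * q_pow q (q * x) (b - 1)"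
    by (rule LIMSEQ_unique)
  then have "(1 - q powr (b - 1) * x) * q_pow q x (b - 1) = (1 - x) * q_pow q (q * x) (b - 1)"
    using x by (simp add: F_def field_simps)
  moreover have "q powr (b - 1) * x = q powr b * q ^ i"
    using q_pos by (simp add: x_def powr_diff)
  ultimately have "(1 - q powr b * q ^ i) * q_pow q x (b - 1) = (1 - x) * q_pow q (q * x) (b - 1)"
    by simp
  then have "(1 - q ^ Suc i) * q_pow q (q * q ^ Suc i) (b - 1) = (1 - q powr b * q ^ i) * q_pow q (q * q ^ i) (b - 1)"
    unfolding x_def by (simp only: power_Suc)
  then have "q powr (a * real (Suc i)) * ((1 - q ^ Suc i) * q_pow q (q * q ^ Suc i) (b - 1))
      = q powr a * q powr (a * real i) * ((1 - q powr b * q ^ i) * q_pow q (q * q ^ i) (b - 1))"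
    by (simp add: distrib_left powr_add)
  then show ?thesis
    unfolding beta_weight_def by (simp only: mult_ac)
qed

lemma beta_weight_shift_left: "beta_weight (a + 1) b i = q ^ i * beta_weight a b i"
  by (simp add: beta_weight_def distrib_right powr_add q_powr_real)

text \<open>
  In fact $K = 1$, but a positive constant cancels from all means, and its existence follows from
  the recurrence in the index alone.
\<close>

lemma beta_weight_shift_right:
  assumes "b > 0"
  shows "\<exists>K>0. \<forall>a i. beta_weight a (b + 1) i = K * (1 - q powr b * q ^ i) * beta_weight a b i"
proof -
  have less: "q powr b * q ^ i < 1" for i
    using q_powr_less_1[of "b + real i"] assms by (simp add: powr_add q_powr_real)
  define K where "K = q_pow q q b / ((1 - q powr b) * q_pow q q (b - 1))"
  have pos: "q_pow q q b > 0" "q_pow q q (b - 1) > 0"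
    using beta_weight_pos[of "b + 1" 0 0] beta_weight_pos[of b 0 0] assms q_pos
    by (auto simp: beta_weight_def)
  have "K > 0"
    using pos less[of 0] by (simp add: K_def)
  moreover have "beta_weight a (b + 1) i = K * (1 - q powr b * q ^ i) * beta_weight a b i" for a i
  proof (induction i)
    case 0
    then show ?case
      using pos less[of 0] by (simp add: beta_weight_def K_def)
  next
    case (Suc i)
    have "(1 - q ^ Suc i) * beta_weight a (b + 1) (Suc i)
        = q powr a * (1 - q powr b * q ^ Suc i) * beta_weight a (b + 1) i"
      using beta_weight_Suc[of "b + 1" i a] assms q_pos by (simp add: powr_add mult_ac)
    also have "\<dots> = K * (1 - q powr b * q ^ Suc i) * (q powr a * (1 - q powr b * q ^ i) * beta_weight a b i)"
      unfolding Suc.IH by (simp only: mult_ac)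
    also have "\<dots> = (1 - q ^ Suc i) * (K * (1 - q powr b * q ^ Suc i) * beta_weight a b (Suc i))"
      unfolding beta_weight_Suc[OF assms, symmetric] by (simp only: mult_ac)
    finally show ?case
      using q_Suc_less_1[of i] by simp
  qed
  ultimately show ?thesis by blast
qed

text \<open>
  By the recurrence, the ratio of consecutive weights tends to $q^a < 1$.
\<close>

lemma summable_beta_weight:
  assumes "a > 0" "b > 0"
  shows "summable (beta_weight a b)"
proof -
  define c where "c = (q powr a + 1) / 2"
  have c: "q powr a < c" "c < 1"
    using q_powr_less_1[OF assms(1)] by (auto simp: c_def)
  have lim: "(\<lambda>i. q ^ i) \<longlonglongrightarrow> 0"
    using q_pos q_less_1 by (intro LIMSEQ_realpow_zero) auto
  have "(\<lambda>i. q powr a * (1 - q powr b * q ^ i) / (1 - q ^ Suc i)) \<longlonglongrightarrow> q powr a * (1 - q powr b * 0) / (1 - 0)"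
    using q_pos q_less_1 by (intro tendsto_intros lim LIMSEQ_Suc[OF lim]) auto
  then have "\<forall>\<^sub>F i in sequentially. q powr a * (1 - q powr b * q ^ i) / (1 - q ^ Suc i) < c"
    using c(1) by (intro order_tendstoD(2)) auto
  then obtain N where N: "q powr a * (1 - q powr b * q ^ i) / (1 - q ^ Suc i) < c" if "i \<ge> N" for i
    by (auto simp: eventually_sequentially)
  show ?thesis
  proof (rule summable_ratio_test[OF c(2)])
    fix i assume "N \<le> i"
    have "1 - q ^ Suc i > 0"
      using q_Suc_less_1[of i] by simp
    then have "beta_weight a b (Suc i) = q powr a * (1 - q powr b * q ^ i) / (1 - q ^ Suc i) * beta_weight a b i"
      using beta_weight_Suc[OF assms(2), of i a] by (simp add: field_simps)
    also have "\<dots> \<le> c * beta_weight a b i"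
      using N[OF \<open>N \<le> i\<close>] beta_weight_pos[OF assms(2)] by (intro mult_right_mono) (auto intro: less_imp_le)
    finally show "norm (beta_weight a b (Suc i)) \<le> c * norm (beta_weight a b i)"
      using beta_weight_pos[OF assms(2)] by (simp add: less_imp_le)
  qed
qed

text \<open>
  In terms of $t = q^i$ this is the bound $g = O(t^{-\gamma})$ as $t \to 0$.
\<close>

definition growth_le :: "real \<Rightarrow> (nat \<Rightarrow> real) \<Rightarrow> bool" where
  "growth_le \<gamma> g \<longleftrightarrow> (\<exists>C. \<forall>\<^sub>F i in sequentially. \<bar>g i\<bar> \<le> C * q powr (- \<gamma> * real i))"

lemma growth_le_const: "growth_le 0 (\<lambda>i. c)"
  using q_pos by (auto simp: growth_le_def)

lemma summable_beta_weight_mult: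
  assumes "b > 0" "growth_le \<gamma> g" "\<gamma> < a"
  shows "summable (\<lambda>i. beta_weight a b i * g i)"
proof -
  obtain C where C: "\<forall>\<^sub>F i in sequentially. \<bar>g i\<bar> \<le> C * q powr (- \<gamma> * real i)"
    using assms(2) by (auto simp: growth_le_def)
  have "\<forall>\<^sub>F i in sequentially. norm (beta_weight a b i * g i) \<le> C * beta_weight (a - \<gamma>) b i"
    using C
  proof eventually_elim
    case (elim i)
    have "norm (beta_weight a b i * g i) \<le> beta_weight a b i * (C * q powr (- \<gamma> * real i))"
      using elim beta_weight_pos[OF assms(1), of a i] by (simp add: abs_mult mult_left_mono)
    also have "\<dots> = C * beta_weight (a - \<gamma>) b i"
      using q_pos by (simp add: beta_weight_def powr_add [symmetric] algebra_simps)
    finally show ?case .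
  qed
  moreover have "summable (\<lambda>i. C * beta_weight (a - \<gamma>) b i)"
    using assms by (intro summable_mult summable_beta_weight) auto
  ultimately show ?thesis
    by (rule summable_comparison_test_ev)
qed

text \<open>
  This is $(1-q)$ times the Jackson derivative $D_q$ at $q^i$.
\<close>

definition q_diff :: "(nat \<Rightarrow> real) \<Rightarrow> nat \<Rightarrow> real" where
  "q_diff g i = (g i - g (Suc i)) / q ^ i"

lemma growth_le_q_diff:
  assumes "growth_le \<gamma> g"
  shows "growth_le (\<gamma> + 1) (q_diff g)"
proof -
  obtain C where C: "\<forall>\<^sub>F i in sequentially. \<bar>g i\<bar> \<le> C * q powr (- \<gamma> * real i)"
    using assms by (auto simp: growth_le_def)
  then have "\<forall>\<^sub>F i in sequentially. \<bar>g (Suc i)\<bar> \<le> C * q powr (- \<gamma> * real (Suc i))"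
    by (rule eventually_compose_filterlim[OF _ filterlim_Suc])
  with C have "\<forall>\<^sub>F i in sequentially. \<bar>q_diff g i\<bar> \<le> (C * (1 + q powr (- \<gamma>))) * q powr (- (\<gamma> + 1) * real i)"
  proof eventually_elim
    case (elim i)
    have "\<bar>q_diff g i\<bar> = \<bar>g i - g (Suc i)\<bar> / q ^ i"
      using q_pos by (simp add: q_diff_def)
    also have "\<dots> \<le> (C * q powr (- \<gamma> * real i) + C * q powr (- \<gamma> * real (Suc i))) / q ^ i"
      using elim q_pos by (intro divide_right_mono) auto
    also have "\<dots> = (C * (1 + q powr (- \<gamma>))) * q powr (- (\<gamma> + 1) * real i)"
      using q_pos by (simp add: algebra_simps powr_add powr_diff powr_minus q_powr_real divide_simps)
    finally show ?case .
  qed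
  then show ?thesis
    unfolding growth_le_def by blast
qed

definition beta_integral :: "real \<Rightarrow> real \<Rightarrow> (nat \<Rightarrow> real) \<Rightarrow> real" where
  "beta_integral a b g = (\<Sum>i. beta_weight a b i * g i)"

definition beta_mean :: "real \<Rightarrow> real \<Rightarrow> (nat \<Rightarrow> real) \<Rightarrow> real" where
  "beta_mean a b g = beta_integral a b g / beta_integral a b (\<lambda>_. 1)"

lemma beta_integral_one_pos: "beta_integral a b (\<lambda>_. 1) > 0" if "a > 0" "b > 0"
  unfolding beta_integral_def
  using that by (auto intro!: suminf_pos summable_beta_weight beta_weight_pos)

lemma beta_mean_nonneg:
  assumes "growth_le \<gamma> g" "\<gamma> < a" "a > 0" "b > 0" "\<And>i. g i \<ge> 0"
  shows "beta_mean a b g \<ge> 0"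
  unfolding beta_mean_def
proof (rule divide_nonneg_pos)
  show "beta_integral a b g \<ge> 0"
    unfolding beta_integral_def using assms
    by (intro suminf_nonneg summable_beta_weight_mult mult_nonneg_nonneg less_imp_le[OF beta_weight_pos])
qed (use assms in \<open>simp add: beta_integral_one_pos\<close>)

text \<open>
  Summation by parts for $h(t) = t^a (1-t)_q^b$, whose value at $q^i$ is $H_i = (1-q^i) w_i$ for
  the weight $w = w_{a,b}$. There is no boundary term, because $H_0 = 0$ and $H_i g_i \to 0$.
  The recurrence for $w$ expresses $H_{i+1}$ through $w_i$.
\<close>

lemma beta_integral_parts:
  assumes "b > 0" "growth_le \<gamma> g" "\<gamma> < a"
  shows "q powr a * (beta_integral (a + 1) b (q_diff g) - q powr b * beta_integral (a + 2) b (q_diff g))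
       = (1 - q powr (a + b)) * beta_integral (a + 1) b g - (1 - q powr a) * beta_integral a b g"
proof -
  let ?w = "beta_weight a b"
  define H where "H = (\<lambda>i. (1 - q ^ i) * ?w i)"
  have H_Suc: "H (Suc i) = q powr a * (1 - q powr b * q ^ i) * ?w i" for i
    using beta_weight_Suc[OF assms(1), of i a] by (simp add: H_def)
  have s: "summable (\<lambda>i. ?w i * g i)"
    by (rule summable_beta_weight_mult[OF assms])
  have st: "summable (\<lambda>i. beta_weight (a + 1) b i * g i)"
    by (rule summable_beta_weight_mult[OF assms(1,2)]) (use assms(3) in simp)
  have sD: "summable (\<lambda>i. beta_weight (a + 1) b i * q_diff g i)"
    by (rule summable_beta_weight_mult[OF assms(1) growth_le_q_diff[OF assms(2)]]) (use assms(3) in simp)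
  have sDt: "summable (\<lambda>i. beta_weight (a + 2) b i * q_diff g i)"
    by (rule summable_beta_weight_mult[OF assms(1) growth_le_q_diff[OF assms(2)]]) (use assms(3) in simp)
  have w2: "beta_weight (a + 2) b i = q ^ i * (q ^ i * ?w i)" for i
    using beta_weight_shift_left[of "a + 1" b i] beta_weight_shift_left[of a b i] by (simp add: add.assoc)
  have HS: "(\<lambda>i. H (Suc i) * g i) = (\<lambda>i. q powr a * (?w i * g i) - q powr (a + b) * (beta_weight (a + 1) b i * g i))"
    unfolding H_Suc beta_weight_shift_left powr_add by (simp add: algebra_simps)
  have Hg: "(\<lambda>i. H i * g i) = (\<lambda>i. ?w i * g i - beta_weight (a + 1) b i * g i)"
    unfolding H_def beta_weight_shift_left by (simp add: algebra_simps)
  have HD: "(\<lambda>i. H (Suc i) * g i - H (Suc i) * g (Suc i))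
      = (\<lambda>i. q powr a * (beta_weight (a + 1) b i * q_diff g i - q powr b * (beta_weight (a + 2) b i * q_diff g i)))"
  proof
    fix i
    have "H (Suc i) * g i - H (Suc i) * g (Suc i) = H (Suc i) * (q ^ i * q_diff g i)"
      using q_pos by (simp add: q_diff_def right_diff_distrib [symmetric])
    then show "H (Suc i) * g i - H (Suc i) * g (Suc i)
        = q powr a * (beta_weight (a + 1) b i * q_diff g i - q powr b * (beta_weight (a + 2) b i * q_diff g i))"
      unfolding H_Suc w2 beta_weight_shift_left by (simp add: algebra_simps)
  qed
  have "(\<lambda>i. H (Suc i) * g i) sums (q powr a * beta_integral a b g - q powr (a + b) * beta_integral (a + 1) b g)"
    unfolding HS beta_integral_def by (intro sums_diff sums_mult summable_sums s st)
  moreover have "(\<lambda>i. H (Suc i) * g (Suc i)) sums (beta_integral a b g - beta_integral (a + 1) b g)"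
  proof -
    have "(\<lambda>i. H i * g i) sums (beta_integral a b g - beta_integral (a + 1) b g)"
      unfolding Hg beta_integral_def by (intro sums_diff summable_sums s st)
    then show ?thesis
      using sums_Suc_iff[of "\<lambda>i. H i * g i"] by (simp add: H_def)
  qed
  ultimately have "(\<lambda>i. H (Suc i) * g i - H (Suc i) * g (Suc i)) sums
      ((q powr a * beta_integral a b g - q powr (a + b) * beta_integral (a + 1) b g)
        - (beta_integral a b g - beta_integral (a + 1) b g))"
    by (rule sums_diff)
  moreover have "(\<lambda>i. H (Suc i) * g i - H (Suc i) * g (Suc i)) sums
      (q powr a * (beta_integral (a + 1) b (q_diff g) - q powr b * beta_integral (a + 2) b (q_diff g)))"
    unfolding HD beta_integral_def by (intro sums_mult sums_diff summable_sums sD sDt)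
  ultimately show ?thesis
    using sums_unique2 by (fastforce simp: algebra_simps)
qed

text \<open>
  All six integrals that enter the identity reduce to the weight $w_{a,b}$ and its multiples by
  powers of $t = q^i$: raising $a$ multiplies by $t$, raising $b$ multiplies by $1 - q^b t$ up to
  a constant. Summation by parts for the constant function $1$ gives the moments of
  $w_{a,b}$ of order one and two, and for $g$ it gives the integral of $\partial g$.
\<close>

lemma beta_mean_step:
  assumes "a > 0" "b > 0" "growth_le \<gamma> g" "\<gamma> < a"
  shows "beta_mean (a + 1) b g - beta_mean a (b + 1) g
       = q powr a / (1 - q powr (a + b + 1)) * beta_mean (a + 1) (b + 1) (q_diff g)"
proof -
  obtain K where K: "K > 0" "\<And>a i. beta_weight a (b + 1) i = K * (1 - q powr b * q ^ i) * beta_weight a b i"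
    using beta_weight_shift_right[OF assms(2)] by metis
  have raise: "beta_integral a' (b + 1) h = K * (beta_integral a' b h - q powr b * beta_integral (a' + 1) b h)"
    if "growth_le \<delta> h" "\<delta> < a'" for a' \<delta> h
  proof -
    have s: "summable (\<lambda>i. beta_weight a' b i * h i)" "summable (\<lambda>i. beta_weight (a' + 1) b i * h i)"
      using that assms(2) by (auto intro!: summable_beta_weight_mult[of b \<delta> h])
    have "(\<lambda>i. beta_weight a' (b + 1) i * h i)
        = (\<lambda>i. K * (beta_weight a' b i * h i - q powr b * (beta_weight (a' + 1) b i * h i)))"
      unfolding K(2) beta_weight_shift_left by (simp add: algebra_simps)
    moreover have "(\<lambda>i. K * (beta_weight a' b i * h i - q powr b * (beta_weight (a' + 1) b i * h i)))
        sums (K * (beta_integral a' b h - q powr b * beta_integral (a' + 1) b h))"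
      unfolding beta_integral_def by (intro sums_mult sums_diff summable_sums s)
    ultimately show ?thesis
      unfolding beta_integral_def[of a' "b + 1"] by (simp only: sums_iff)
  qed
  define A B where "A = q powr a" and "B = q powr b"
  have AB: "0 < A" "A < 1" "0 < B" "B < 1" "A * B < 1" "q * A * B < 1"
    using q_powr_less_1 assms(1,2) q_pos q_powr_less_1[of "a + b"] q_powr_less_1[of "a + b + 1"]
    by (auto simp: A_def B_def powr_add mult_ac)
  \<comment> \<open>Moments of order 0, 1, 2 of the weight, and of order 0, 1 of the weight times g.\<close>
  define S0 S1 S2 G0 G1 where "S0 = beta_integral a b (\<lambda>_. 1)" and "S1 = beta_integral (a + 1) b (\<lambda>_. 1)"
    and "S2 = beta_integral (a + 2) b (\<lambda>_. 1)" and "G0 = beta_integral a b g" and "G1 = beta_integral (a + 1) b g"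
  have S0: "S0 > 0"
    using assms by (simp add: S0_def beta_integral_one_pos)
  have D1: "q_diff (\<lambda>_. 1) = (\<lambda>_. 0)"
    by (auto simp: q_diff_def)
  have "(1 - A * B) * S1 = (1 - A) * S0"
    using beta_integral_parts[OF assms(2) growth_le_const assms(1), of 1]
    by (simp add: D1 S0_def S1_def A_def B_def beta_integral_def powr_add)
  then have S1: "S1 = (1 - A) * S0 / (1 - A * B)"
    using AB by (simp add: field_simps)
  have "(1 - q * A * B) * S2 = (1 - q * A) * S1"
    using beta_integral_parts[OF assms(2) growth_le_const, of "a + 1" 1] assms(1) q_pos
    by (simp add: D1 S2_def S1_def A_def B_def beta_integral_def powr_add mult_ac add.assoc)
  then have S2: "S2 = (1 - q * A) * S1 / (1 - q * A * B)"
    using AB by (simp add: field_simps)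
  have den0: "S0 - B * S1 = (1 - B) * S0 / (1 - A * B)"
    unfolding S1 using AB by (simp add: field_simps)
  have den1: "S1 - B * S2 = (1 - B) * S1 / (1 - q * A * B)"
    unfolding S2 using AB by (simp add: field_simps)
  have one: "beta_integral a (b + 1) (\<lambda>_. 1) = K * (S0 - B * S1)"
    "beta_integral (a + 1) (b + 1) (\<lambda>_. 1) = K * (S1 - B * S2)"
    using raise[OF growth_le_const, of a 1] raise[OF growth_le_const, of "a + 1" 1] assms(1)
    by (simp_all add: S0_def S1_def S2_def B_def add.assoc)
  have num: "beta_integral a (b + 1) g = K * (G0 - B * G1)"
    using raise[OF assms(3,4)] by (simp add: G0_def G1_def B_def)
  have "beta_integral (a + 1) (b + 1) (q_diff g)
      = K * (beta_integral (a + 1) b (q_diff g) - B * beta_integral (a + 2) b (q_diff g))"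
    using raise[OF growth_le_q_diff[OF assms(3)], of "a + 1"] assms(4) by (simp add: B_def add.assoc)
  moreover have "A * (beta_integral (a + 1) b (q_diff g) - B * beta_integral (a + 2) b (q_diff g))
      = (1 - A * B) * G1 - (1 - A) * G0"
    using beta_integral_parts[OF assms(2,3,4)] by (simp add: G0_def G1_def A_def B_def powr_add)
  ultimately have "A * beta_integral (a + 1) (b + 1) (q_diff g) = K * ((1 - A * B) * G1 - (1 - A) * G0)"
    by (metis mult.left_commute)
  then have dif: "beta_integral (a + 1) (b + 1) (q_diff g) = K * ((1 - A * B) * G1 - (1 - A) * G0) / A"
    using AB by (simp add: field_simps)
  have "G1 / S1 - K * (G0 - B * G1) / (K * (S0 - B * S1))
      = A / (1 - q * A * B) * (K * ((1 - A * B) * G1 - (1 - A) * G0) / A / (K * (S1 - B * S2)))"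
  proof -
    have "G1 / S1 - K * (G0 - B * G1) / (K * (S0 - B * S1))
        = (1 - A * B) / S0 * (G1 / (1 - A) - (G0 - B * G1) / (1 - B))"
    proof -
      have "K * (G0 - B * G1) / (K * (S0 - B * S1)) = (1 - A * B) / S0 * ((G0 - B * G1) / (1 - B))"
        unfolding den0 using K(1) by (simp add: mult.commute)
      moreover have "G1 / S1 = (1 - A * B) / S0 * (G1 / (1 - A))"
        unfolding S1 by (simp add: mult.commute)
      ultimately show ?thesis
        by (simp only: right_diff_distrib)
    qed
    also have "\<dots> = (1 - A * B) / S0 * (((1 - A * B) * G1 - (1 - A) * G0) / ((1 - A) * (1 - B)))"
      using AB by (simp add: divide_simps) (simp add: algebra_simps)
    also have "\<dots> = A / (1 - q * A * B) * (K * ((1 - A * B) * G1 - (1 - A) * G0) / A / (K * (S1 - B * S2)))"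
      unfolding den1 unfolding S1 using K(1) AB S0 by (simp add: divide_simps)
    finally show ?thesis .
  qed
  moreover have "q powr (a + b + 1) = q * A * B"
    using q_pos by (simp add: powr_add A_def B_def)
  ultimately show ?thesis
    by (simp add: beta_mean_def one num dif G1_def S1_def A_def)
qed

section \<open>The q-Bernstein basis\<close>

text \<open>
  The basis function $b_{n,k,q}$ without its binomial coefficient, which cancels whenever basis
  functions of the same index are compared at different points.
\<close>

definition bernstein_monomial :: "nat \<Rightarrow> nat \<Rightarrow> real \<Rightarrow> real" where
  "bernstein_monomial n k x = x ^ k * (\<Prod>j<n - k. 1 - q ^ j * x)"

definition bernstein_form :: "nat \<Rightarrow> (nat \<Rightarrow> real) \<Rightarrow> real \<Rightarrow> real" where
  "bernstein_form n c x = (\<Sum>k\<le>n. c k * (q_binomial q n k * bernstein_monomial n k x))"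

lemma one_minus_q_power_nonneg: "0 \<le> 1 - q ^ j * x" if "0 \<le> x" "x \<le> 1"
  using mult_mono[of "q ^ j" 1 x 1] that q_pos q_less_1 by (simp add: power_le_one)

lemma one_minus_q_power_pos: "0 < 1 - q ^ j * x" if "0 \<le> x" "x < 1"
proof -
  have "q ^ j * x \<le> 1 * x"
    using that q_pos q_less_1 by (intro mult_right_mono power_le_one) auto
  then show ?thesis using that by simp
qed

lemma bernstein_monomial_nonneg: "bernstein_monomial n k x \<ge> 0" if "0 \<le> x" "x \<le> 1"
  using that one_minus_q_power_nonneg by (auto simp: bernstein_monomial_def intro!: mult_nonneg_nonneg prod_nonneg)

lemma bernstein_monomial_pos: "bernstein_monomial n k x > 0" if "0 < x" "x < 1"
  using that one_minus_q_power_pos by (auto simp: bernstein_monomial_def intro!: mult_pos_pos prod_pos)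

lemma bernstein_monomial_Suc:
  assumes "k < n"
  shows "(1 - q ^ (n - Suc k) * x) * bernstein_monomial n (Suc k) x = x * bernstein_monomial n k x"
proof -
  have "n - k = Suc (n - Suc k)" using assms by simp
  then show ?thesis by (simp add: bernstein_monomial_def)
qed

lemma bernstein_monomial_pred:
  assumes "k < n"
  shows "bernstein_monomial n k x = (1 - q ^ (n - Suc k) * x) * bernstein_monomial (n - 1) k x"
proof -
  have "n - k = Suc (n - Suc k)" "n - 1 - k = n - Suc k" using assms by auto
  then show ?thesis by (simp add: bernstein_monomial_def)
qed

text \<open>
  One step in the index multiplies the basis function by $x / (1 - q^{n-k-1} x)$, which increases
  in $x$. The proof divides by the denominator at $x < 1$ only, so $z = 1$ is included.
\<close>

lemma bernstein_monomial_le_mono: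
  assumes "0 \<le> x" "x < z" "z \<le> 1" "j \<le> k" "k \<le> n"
    and "bernstein_monomial n j x \<le> bernstein_monomial n j z"
  shows "bernstein_monomial n k x \<le> bernstein_monomial n k z"
  using assms(4,5)
proof (induction k rule: dec_induct)
  case base
  show ?case by (rule assms)
next
  case (step k)
  let ?r = "q ^ (n - Suc k)"
  have "(1 - ?r * x) * bernstein_monomial n (Suc k) x = x * bernstein_monomial n k x"
    using step by (intro bernstein_monomial_Suc) auto
  also have "\<dots> \<le> z * bernstein_monomial n k z"
    using step assms by (intro mult_mono bernstein_monomial_nonneg) auto
  also have "\<dots> = (1 - ?r * z) * bernstein_monomial n (Suc k) z"
    using step by (intro bernstein_monomial_Suc[symmetric]) auto
  also have "\<dots> \<le> (1 - ?r * x) * bernstein_monomial n (Suc k) z"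
    using assms q_pos by (intro mult_right_mono bernstein_monomial_nonneg) auto
  finally show ?case
    using one_minus_q_power_pos[of x "n - Suc k"] assms by (simp add: mult_le_cancel_left_pos)
qed

lemma q_fact_Suc: "q_fact q (Suc n) = q_fact q n * ((1 - q ^ Suc n) / (1 - q))"
  using q_powr_real[of "Suc n"] by (simp add: q_fact_def q_bracket_def)

lemma q_fact_pos: "q_fact q n > 0"
proof (induction n)
  case 0
  show ?case by (simp add: q_fact_def)
next
  case (Suc n)
  then show ?case
    using q_less_1 q_Suc_less_1[of n] by (simp add: q_fact_Suc)
qed

lemma q_binomial_pos: "q_binomial q n k > 0"
  by (simp add: q_binomial_def q_fact_pos)

lemma q_binomial_0: "q_binomial q n 0 = 1"
  using q_fact_pos[of n] by (simp add: q_binomial_def) (simp add: q_fact_def)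

lemma q_binomial_self: "q_binomial q n n = 1"
  using q_fact_pos[of n] by (simp add: q_binomial_def) (simp add: q_fact_def)

lemma q_binomial_pascal:
  assumes "k < n"
  shows "q_binomial q (Suc n) (Suc k) = q_binomial q n (Suc k) + q ^ (n - k) * q_binomial q n k"
proof -
  obtain m where n: "n = k + Suc m"
    using assms by (metis add_Suc_right less_imp_Suc_add)
  define A B P X where "A = q ^ Suc k" and "B = q ^ Suc m" and "P = 1 - q"
    and "X = q_fact q n * P / (q_fact q k * q_fact q m)"
  have nz: "1 - A \<noteq> 0" "1 - B \<noteq> 0" "P \<noteq> 0"
    using q_less_1 q_Suc_less_1[of k] q_Suc_less_1[of m] by (auto simp: A_def B_def P_def)
  have diffs: "n - k = Suc m" "n - Suc k = m"
    by (simp_all add: n)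
  have AB: "q ^ Suc n = A * B"
    by (simp add: A_def B_def n power_add)
  have fact: "q_fact q (Suc n) = q_fact q n * ((1 - A * B) / P)"
    "q_fact q (Suc k) = q_fact q k * ((1 - A) / P)" "q_fact q (Suc m) = q_fact q m * ((1 - B) / P)"
    unfolding AB[symmetric] unfolding A_def B_def P_def by (rule q_fact_Suc)+
  have "q_binomial q (Suc n) (Suc k) = X * ((1 - A * B) / ((1 - A) * (1 - B)))"
    using nz by (simp add: q_binomial_def fact diffs X_def mult_ac)
  also have "(1 - A * B) / ((1 - A) * (1 - B)) = 1 / (1 - A) + B / (1 - B)"
    using nz by (simp add: divide_simps) (simp add: algebra_simps)
  also have "X * (1 / (1 - A) + B / (1 - B)) = X / (1 - A) + B * (X / (1 - B))"
    by (simp add: algebra_simps)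
  also have "X / (1 - A) = q_binomial q n (Suc k)"
    using nz by (simp add: q_binomial_def fact diffs X_def mult_ac)
  also have "X / (1 - B) = q_binomial q n k"
    using nz by (simp add: q_binomial_def fact diffs X_def mult_ac)
  also have "B = q ^ (n - k)"
    by (simp add: B_def n)
  finally show ?thesis .
qed

text \<open>
  By the $q$-Pascal rule the coefficients of degree $n$ are those of degree $n+1$ after one
  interpolation step between neighbours. This evaluates the form for $c_k = 1$ and $c_k = q^k$
  by induction on the degree.
\<close>

lemma bernstein_form_Suc:
  "bernstein_form (Suc n) c x
    = bernstein_form n (\<lambda>k. c k + q ^ (n - k) * x * (c (Suc k) - c k)) x"
proof -
  let ?b = "q_binomial q" and ?B = "bernstein_monomial"
  have B1: "?B (Suc n) k x = (1 - q ^ (n - k) * x) * ?B n k x" if "k \<le> n" for k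
    using bernstein_monomial_pred[of k "Suc n" x] that by simp
  have B2: "?B (Suc n) (Suc k) x = x * ?B n k x" for k
    by (simp add: bernstein_monomial_def)
  have "bernstein_form (Suc n) c x
      = c 0 * ?B (Suc n) 0 x + (\<Sum>k<n. c (Suc k) * (?b (Suc n) (Suc k) * ?B (Suc n) (Suc k) x))
        + c (Suc n) * ?B (Suc n) (Suc n) x"
    by (simp add: bernstein_form_def sum.atMost_shift q_binomial_0 q_binomial_self)
  also have "(\<Sum>k<n. c (Suc k) * (?b (Suc n) (Suc k) * ?B (Suc n) (Suc k) x))
      = (\<Sum>k<n. c (Suc k) * (?b n (Suc k) * ?B (Suc n) (Suc k) x))
        + (\<Sum>k<n. c (Suc k) * (q ^ (n - k) * ?b n k * ?B (Suc n) (Suc k) x))"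
    by (simp add: q_binomial_pascal sum.distrib [symmetric] algebra_simps)
  also have "c 0 * ?B (Suc n) 0 x + \<dots> + c (Suc n) * ?B (Suc n) (Suc n) x
      = (\<Sum>k\<le>n. c k * (?b n k * ?B (Suc n) k x))
        + (\<Sum>k\<le>n. c (Suc k) * (q ^ (n - k) * ?b n k * ?B (Suc n) (Suc k) x))"
    unfolding sum.atMost_shift[of "\<lambda>k. c k * (?b n k * ?B (Suc n) k x)"]
    by (simp add: q_binomial_0 q_binomial_self lessThan_Suc_atMost [symmetric])
  also have "\<dots> = bernstein_form n (\<lambda>k. c k + q ^ (n - k) * x * (c (Suc k) - c k)) x"
    by (simp add: bernstein_form_def B1 B2 sum.distrib [symmetric] algebra_simps)
  finally show ?thesis .
qed

lemma bernstein_form_one: "bernstein_form n (\<lambda>_. 1) x = 1"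
proof (induction n)
  case 0
  show ?case by (simp add: bernstein_form_def bernstein_monomial_def q_binomial_0)
qed (simp add: bernstein_form_Suc)

lemma bernstein_form_affine:
  "bernstein_form n (\<lambda>k. A * c k + B * d k) x = A * bernstein_form n c x + B * bernstein_form n d x"
  by (simp add: bernstein_form_def sum.distrib sum_distrib_left algebra_simps)

lemma bernstein_form_q_power: "bernstein_form n (\<lambda>k. q ^ k) x = 1 - (1 - q ^ n) * x"
proof (induction n)
  case 0
  show ?case by (simp add: bernstein_form_def bernstein_monomial_def q_binomial_0)
next
  case (Suc n)
  have "q ^ k + q ^ (n - k) * x * (q ^ Suc k - q ^ k) = 1 * q ^ k + ((q - 1) * q ^ n * x) * 1"
    if "k \<le> n" for k
  proof -
    have "q ^ n = q ^ (n - k) * q ^ k"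
      using that by (simp add: power_add [symmetric])
    then show ?thesis
      by (simp add: algebra_simps)
  qed
  then have "bernstein_form (Suc n) (\<lambda>k. q ^ k) x
      = bernstein_form n (\<lambda>k. 1 * q ^ k + ((q - 1) * q ^ n * x) * 1) x"
    unfolding bernstein_form_Suc unfolding bernstein_form_def
    by (intro sum.cong refl) (simp only: atMost_iff)
  also have "\<dots> = 1 - (1 - q ^ Suc n) * x"
    unfolding bernstein_form_affine bernstein_form_one Suc.IH by (simp add: algebra_simps)
  finally show ?case .
qed

text \<open>
  The difference of the basis functions at two points $x < y$ changes sign at most once in $k$ and
  has sum zero.
\<close>

lemma bernstein_form_mono:
  assumes "\<And>k. k < n \<Longrightarrow> c k \<le> c (Suc k)"
  shows "mono_on {0..1} (bernstein_form n c)"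
proof (rule mono_onI)
  fix x y :: real assume xy: "x \<in> {0..1}" "y \<in> {0..1}" "x \<le> y"
  show "bernstein_form n c x \<le> bernstein_form n c y"
  proof (cases "x = y")
    case False
    let ?B = "bernstein_monomial n"
    define w where "w = (\<lambda>k. q_binomial q n k * (?B k x - ?B k y))"
    have diff: "(\<Sum>k<Suc n. d k * w k) = bernstein_form n d x - bernstein_form n d y" for d
      by (simp add: w_def bernstein_form_def lessThan_Suc_atMost sum_subtractf [symmetric] algebra_simps)
    have "(\<Sum>k<Suc n. c k * w k) \<le> 0"
    proof (rule single_crossing_sum_nonpos)
      show "(\<Sum>k<Suc n. w k) = 0"
        using diff[of "\<lambda>_. 1"] by (simp add: bernstein_form_one)
    next
      fix i j assume "j \<le> i" "i < Suc n" "w j < 0"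
      then show "w i \<le> 0"
        using bernstein_monomial_le_mono[of x y j i n] xy False q_binomial_pos[of n j] q_binomial_pos[of n i]
        by (auto simp: w_def mult_less_0_iff intro!: mult_nonneg_nonpos)
    next
      fix i j assume "j \<le> i" "i < Suc n"
      then show "c j \<le> c i"
        by (induction i rule: dec_induct) (auto intro: order_trans assms)
    qed
    then show ?thesis
      by (simp only: diff)
  qed simp
qed

text \<open>
  For fixed $y$ and $k$ the right-hand side is, up to a positive factor, $x - y$ times a basis
  function of degree $n - 1$ at $x$. In the proof of convexity the factors $x - y$ and $z - y$
  balance the weights of $x$ and $z$, which leaves a plain difference of basis functions.
\<close>

lemma bernstein_ratio_diff:
  assumes "0 < y" "y < 1" "k < n"
  shows "bernstein_monomial n (Suc k) x / bernstein_monomial n (Suc k) y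
      - bernstein_monomial n k x / bernstein_monomial n k y
    = (x - y) * bernstein_monomial (n - 1) k x / (y * bernstein_monomial n k y)"
proof -
  let ?B = "bernstein_monomial" and ?r = "q ^ (n - Suc k)"
  have pos: "?B n k y > 0" "?B n (Suc k) y > 0" "1 - ?r * y > 0"
    using bernstein_monomial_pos[OF assms(1,2)] one_minus_q_power_pos[OF less_imp_le[OF assms(1)] assms(2)]
    by blast+
  have B: "?B n (Suc k) x = x * ?B (n - 1) k x"
    using assms(3) by (auto simp: bernstein_monomial_def)
  have By: "?B n (Suc k) y = y * ?B n k y / (1 - ?r * y)"
    using bernstein_monomial_Suc[OF assms(3), of y] pos by (simp add: field_simps)
  have "?B n (Suc k) x / ?B n (Suc k) y
      = x * (1 - ?r * y) * ?B (n - 1) k x / (y * ?B n k y)"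
    unfolding By B using pos by simp
  moreover have "?B n k x / ?B n k y = y * (1 - ?r * x) * ?B (n - 1) k x / (y * ?B n k y)"
    unfolding bernstein_monomial_pred[OF assms(3), of x] using assms(1) by simp
  ultimately show ?thesis
    by (simp add: diff_divide_distrib [symmetric] algebra_simps)
qed

text \<open>
  The proof tests convexity at $y = (1-t) x + t z$ by pairing $c$ with the defect $v$ of the basis
  functions. Relative to the basis at $y$ the defect is $r_k - 1$, where $r$ first decreases and
  then increases; so $v$ has the sign pattern $+, -, +$.
\<close>

lemma bernstein_form_convex:
  assumes convex: "\<And>k. Suc k < n \<Longrightarrow> (c (Suc k) - c k) / q ^ k \<le> (c (Suc (Suc k)) - c (Suc k)) / q ^ Suc k"
  shows "convex_on {0..1} (bernstein_form n c)"
proof (rule convex_on_linorderI)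
  fix t x z :: real
  assume t: "0 < t" "t < 1" and xz: "x \<in> {0..1}" "z \<in> {0..1}" "x < z"
  define y where "y = (1 - t) *\<^sub>R x + t *\<^sub>R z"
  let ?B = "bernstein_monomial n"
  have yx: "y - x = t * (z - x)" and zy: "z - y = (1 - t) * (z - x)"
    by (simp_all add: y_def real_scaleR_def algebra_simps)
  have "0 < y - x" "0 < z - y"
    unfolding yx zy using t xz by auto
  then have y: "0 < y" "y < 1"
    using xz by auto
  define r where "r = (\<lambda>k. ((1 - t) * ?B k x + t * ?B k z) / ?B k y)"
  define v where "v = (\<lambda>k. q_binomial q n k * ((1 - t) * ?B k x + t * ?B k z - ?B k y))"
  have By: "?B k y > 0" for k
    by (rule bernstein_monomial_pos[OF y])
  have v_r: "v k = q_binomial q n k * ?B k y * (r k - 1)" for k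
    using By[of k] by (simp add: v_def r_def right_diff_distrib)
  have v_sign: "v k < 0 \<longleftrightarrow> r k < 1" "v k > 0 \<longleftrightarrow> r k > 1" "v k \<ge> 0 \<longleftrightarrow> r k \<ge> 1" for k
  proof -
    have "q_binomial q n k * ?B k y > 0"
      using By q_binomial_pos by (intro mult_pos_pos)
    then obtain K where "K > 0" "v k = K * (r k - 1)"
      using v_r by blast
    then show "v k < 0 \<longleftrightarrow> r k < 1" "v k > 0 \<longleftrightarrow> r k > 1" "v k \<ge> 0 \<longleftrightarrow> r k \<ge> 1"
      by (auto simp: mult_less_0_iff zero_less_mult_iff zero_le_mult_iff)
  qed
  have form: "(\<Sum>k\<le>n. d k * v k)
      = (1 - t) * bernstein_form n d x + t * bernstein_form n d z - bernstein_form n d y" for d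
    by (simp add: v_def bernstein_form_def sum_distrib_left sum.distrib sum_subtractf algebra_simps)
  define \<delta> where "\<delta> = (\<lambda>k. bernstein_monomial (n - 1) k z - bernstein_monomial (n - 1) k x)"
  \<comment> \<open>Both (1 - t) (y - x) and t (z - y) equal t (1 - t) (z - x), so this factor can be taken out.\<close>
  have r_Suc: "\<exists>K>0. r (Suc k) - r k = K * \<delta> k" if "k < n" for k
  proof -
    define C where "C = y * ?B k y"
    have C: "C > 0"
      and d: "\<And>u. ?B (Suc k) u / ?B (Suc k) y - ?B k u / ?B k y = (u - y) * bernstein_monomial (n - 1) k u / C"
      using bernstein_ratio_diff[OF y that] y By[of k] by (simp_all add: C_def)
    have "r (Suc k) - r k = (1 - t) * (?B (Suc k) x / ?B (Suc k) y - ?B k x / ?B k y)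
        + t * (?B (Suc k) z / ?B (Suc k) y - ?B k z / ?B k y)"
      by (simp only: r_def add_divide_distrib right_diff_distrib times_divide_eq_right)
    also have "\<dots> = ((z - y) * t * bernstein_monomial (n - 1) k z
        - (y - x) * (1 - t) * bernstein_monomial (n - 1) k x) / C"
      unfolding d using C by (simp add: divide_simps) (simp add: algebra_simps)
    also have "\<dots> = ((1 - t) * t * (z - x) / C) * \<delta> k"
      unfolding yx zy \<delta>_def times_divide_eq_left
      by (rule arg_cong[where f = "\<lambda>u. u / C"]) (simp add: algebra_simps)
    finally show ?thesis
      using C t xz by (intro exI[of _ "(1 - t) * t * (z - x) / C"]) auto
  qed
  have \<delta>_mono: "\<delta> i \<ge> 0" if "\<delta> j \<ge> 0" "j \<le> i" "i < n" for i j
    using bernstein_monomial_le_mono[of x z j i "n - 1"] xz that by (auto simp: \<delta>_def)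
  have "(\<Sum>k\<le>n. c k * v k) \<ge> 0"
  proof (rule convex_sequence_sum_nonneg[where u = "\<lambda>k. - (q ^ k)"])
    show "(\<Sum>k\<le>n. v k) = 0"
      using form[of "\<lambda>_. 1"] by (simp add: bernstein_form_one)
    \<comment> \<open>The form with coefficients q^k is affine in the variable.\<close>
    show "(\<Sum>k\<le>n. - (q ^ k) * v k) = 0"
      using form[of "\<lambda>k. q ^ k"] by (simp add: bernstein_form_q_power sum_negf y_def algebra_simps)
    show "- (q ^ j) < - (q ^ Suc j)" for j
      using q_pos q_less_1 by simp
  next
    fix i k l assume ikl: "i < k" "k \<le> l" "l \<le> n" "v i < 0" "v k > 0"
    \<comment> \<open>From v i < 0 < v k it follows that r increases somewhere between i and k, and from there on.\<close>
    have "\<exists>j. i \<le> j \<and> j < k \<and> r j < r (Suc j)"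
    proof (rule ccontr)
      assume *: "\<not> ?thesis"
      have "r k \<le> r i"
        using less_imp_le[OF ikl(1)]
      proof (induction k rule: dec_induct)
        case (step m)
        then show ?case using * ikl by force
      qed simp
      then show False
        using ikl v_sign by (meson less_le_trans not_less order.strict_trans2 order_less_asym)
    qed
    then obtain j where j: "i \<le> j" "j < k" "r j < r (Suc j)" by blast
    then have "\<delta> j \<ge> 0"
      using r_Suc[of j] ikl by (smt (verit) mult_nonneg_nonpos order_less_le_trans)
    have "r k \<le> r l"
      using ikl(2,3)
    proof (induction l rule: dec_induct)
      case (step m)
      have "\<delta> m \<ge> 0"
        using \<delta>_mono[OF \<open>\<delta> j \<ge> 0\<close>] j step by auto
      then have "r m \<le> r (Suc m)"
        using r_Suc[of m] step by (smt (verit) Suc_le_lessD mult_nonneg_nonneg)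
      then show ?case using step by simp
    qed simp
    then show "v l \<ge> 0"
      using v_sign(2)[of k] v_sign(3)[of l] ikl by simp
  next
    fix i j assume "j \<le> i" "i < n"
    then have "(c (Suc j) - c j) / q ^ j \<le> (c (Suc i) - c i) / q ^ i"
    proof (induction i rule: dec_induct)
      case (step m)
      then show ?case
        using convex[of m] by (meson Suc_lessD order_trans)
    qed simp
    moreover have "- (q ^ Suc m) - - (q ^ m) = q ^ m * (1 - q)" for m
      by (simp add: algebra_simps)
    moreover have "1 - q > 0"
      using q_less_1 by simp
    ultimately show "(c (Suc j) - c j) / (- (q ^ Suc j) - - (q ^ j)) \<le> (c (Suc i) - c i) / (- (q ^ Suc i) - - (q ^ i))"
      by (simp only: divide_divide_eq_left [symmetric] divide_right_mono less_imp_le)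
  qed
  then show "bernstein_form n c ((1 - t) *\<^sub>R x + t *\<^sub>R z)
      \<le> (1 - t) * bernstein_form n c x + t * bernstein_form n c z"
    unfolding form y_def by simp
qed simp

section \<open>The Durrmeyer operator\<close>

definition node :: "real \<Rightarrow> nat \<Rightarrow> real" where
  "node \<beta> i = q powr (\<beta> + 1) * q ^ i"

lemma node_pos: "node \<beta> i > 0"
  using q_pos by (simp add: node_def)

lemma node_less_1:
  assumes "\<beta> > -1"
  shows "node \<beta> i < 1"
proof -
  have "node \<beta> i = q powr (\<beta> + 1 + real i)"
    by (simp add: node_def powr_add q_powr_real)
  then show ?thesis
    using q_powr_less_1[of "\<beta> + 1 + real i"] assms by simp
qed

lemma node_Suc: "node \<beta> (Suc i) = q * node \<beta> i"
  by (simp add: node_def)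

lemma node_Suc_less: "node \<beta> (Suc i) < node \<beta> i"
  using node_pos[of \<beta> i] q_less_1 by (simp add: node_Suc)

text \<open>
  Condition $C(\alpha)$ controls $f$ near $0$ only, which is where all but finitely many nodes lie.
  The bound on $\gamma$ is what makes the coefficient with $k = 0$, whose weight has
  $a = \alpha + 1$, summable.
\<close>

lemma growth_le_node:
  assumes "condition_C \<alpha> f" "\<beta> > -1"
  obtains \<gamma> where "\<gamma> < \<alpha> + 1" "growth_le \<gamma> (\<lambda>i. f (node \<beta> i))"
proof -
  obtain \<gamma> A where \<gamma>: "\<alpha> > \<gamma> - 1" and A: "A \<in> {0<..1}"
    and bdd: "bounded ((\<lambda>x. x powr \<gamma> * f x) ` ({0<..A} \<inter> {0<..<1}))"
    using assms(1) by (auto simp: condition_C_def)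
  obtain C where C: "\<bar>x powr \<gamma> * f x\<bar> \<le> C" if "0 < x" "x \<le> A" "x < 1" for x
    using bdd by (fastforce simp: bounded_iff)
  have "(\<lambda>i. node \<beta> i) \<longlonglongrightarrow> q powr (\<beta> + 1) * 0"
    unfolding node_def using q_pos q_less_1 by (intro tendsto_intros LIMSEQ_realpow_zero) auto
  then have "\<forall>\<^sub>F i in sequentially. node \<beta> i < A"
    using A by (intro order_tendstoD(2)) auto
  then have "\<forall>\<^sub>F i in sequentially.
      \<bar>f (node \<beta> i)\<bar> \<le> (C * q powr (- \<gamma> * (\<beta> + 1))) * q powr (- \<gamma> * real i)"
  proof eventually_elim
    case (elim i)
    define x where "x = node \<beta> i"
    have x: "0 < x" "x \<le> A" "x < 1"
      using elim node_pos node_less_1[OF assms(2)] by (auto simp: x_def)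
    have "\<bar>f x\<bar> = \<bar>x powr \<gamma> * f x\<bar> * x powr (- \<gamma>)"
      using x by (simp add: abs_mult powr_minus field_simps)
    also have "\<dots> \<le> C * x powr (- \<gamma>)"
      using C[OF x] by (intro mult_right_mono) auto
    also have "x powr (- \<gamma>) = q powr (- \<gamma> * (\<beta> + 1)) * q powr (- \<gamma> * real i)"
    proof -
      have "x = q powr (\<beta> + 1 + real i)"
        by (simp add: x_def node_def powr_add q_powr_real)
      then have "x powr (- \<gamma>) = q powr ((\<beta> + 1 + real i) * - \<gamma>)"
        by (simp only: powr_powr)
      also have "(\<beta> + 1 + real i) * - \<gamma> = - \<gamma> * (\<beta> + 1) + - \<gamma> * real i"
        by (simp add: algebra_simps)
      finally show ?thesis
        by (simp only: powr_add)
    qed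
    finally show ?case
      by (simp add: x_def mult.assoc)
  qed
  then have "growth_le \<gamma> (\<lambda>i. f (node \<beta> i))"
    unfolding growth_le_def by blast
  then show ?thesis
    using \<gamma> by (intro that[of \<gamma>]) auto
qed

lemma q_durrmeyer_coeff_eq_beta_mean:
  assumes "k \<le> n"
  shows "q_durrmeyer_coeff q \<alpha> \<beta> n k f
    = beta_mean (real k + \<alpha> + 1) (real (n - k) + \<beta> + 1) (\<lambda>i. f (node \<beta> i))"
proof -
  have weight: "q ^ i * ((q ^ i) powr (real k + \<alpha>) * q_pow q (q * q ^ i) (real n - real k + \<beta>) * y)
      = beta_weight (real k + \<alpha> + 1) (real (n - k) + \<beta> + 1) i * y" for i y
  proof -
    have "(q ^ i) powr (real k + \<alpha>) = q powr ((real k + \<alpha>) * real i)"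
      using q_pos by (simp add: powr_powr mult.commute flip: q_powr_real)
    moreover have "(real k + \<alpha> + 1) * real i = real i + (real k + \<alpha>) * real i"
      by (simp add: algebra_simps)
    ultimately have "q ^ i * (q ^ i) powr (real k + \<alpha>) = q powr ((real k + \<alpha> + 1) * real i)"
      by (simp only: powr_add q_powr_real)
    moreover have "real n - real k + \<beta> = real (n - k) + \<beta> + 1 - 1"
      using assms by simp
    ultimately show ?thesis
      by (simp only: beta_weight_def mult.assoc [symmetric])
  qed
  let ?I = "beta_integral (real k + \<alpha> + 1) (real (n - k) + \<beta> + 1)"
  have "jackson_integral q 1 (\<lambda>t. t powr (real k + \<alpha>) * q_pow q (q * t) (real n - real k + \<beta>)
      * f (q powr (\<beta> + 1) * t)) = (1 - q) * ?I (\<lambda>i. f (node \<beta> i))"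
    by (simp only: jackson_integral_def beta_integral_def node_def mult_1_left mult_1_right weight)
  moreover have "jackson_integral q 1 (\<lambda>t. t powr (real k + \<alpha>) * q_pow q (q * t) (real n - real k + \<beta>))
      = (1 - q) * ?I (\<lambda>_. 1)"
    using weight[of _ 1] by (simp only: jackson_integral_def beta_integral_def mult_1_left mult_1_right)
  ultimately show ?thesis
    using q_less_1 by (simp add: q_durrmeyer_coeff_def beta_mean_def)
qed

lemma q_durrmeyer_eq_bernstein_form:
  assumes "x \<in> {0..1}"
  shows "q_durrmeyer q \<alpha> \<beta> n f x = bernstein_form n (\<lambda>k. q_durrmeyer_coeff q \<alpha> \<beta> n k f) x"
  unfolding q_durrmeyer_def bernstein_form_def atMost_atLeast0
proof (rule sum.cong)
  fix k assume "k \<in> {0..n}"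
  then have "real n - real k = real (n - k)"
    by simp
  moreover have "q_pow q x (real (n - k)) = (\<Prod>j<n - k. 1 - q ^ j * x)"
    using assms by (intro q_pow_of_nat) auto
  ultimately show "q_durrmeyer_coeff q \<alpha> \<beta> n k f * q_bernstein q n k x
      = q_durrmeyer_coeff q \<alpha> \<beta> n k f * (q_binomial q n k * bernstein_monomial n k x)"
    by (simp only: q_bernstein_def bernstein_monomial_def mult.assoc)
qed simp

text \<open>
  Consecutive members of the family have parameters $(a, b+1)$ and $(a+1, b)$. The right-hand side
  contains the member of the same index $k$ for $\alpha + 1$, so the identity can be iterated.
\<close>

lemma beta_mean_diff:
  assumes "growth_le \<gamma> g" "\<gamma> < \<alpha> + 1" "\<alpha> > -1" "\<beta> > -1" "k < n"
  shows "beta_mean (real (Suc k) + \<alpha> + 1) (real (n - Suc k) + \<beta> + 1) g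
      - beta_mean (real k + \<alpha> + 1) (real (n - k) + \<beta> + 1) g
    = q ^ k * (q powr (\<alpha> + 1) / (1 - q powr (real n + \<alpha> + \<beta> + 2)))
      * beta_mean (real k + (\<alpha> + 1) + 1) (real (n - k) + \<beta> + 1) (q_diff g)"
proof -
  define a b where "a = real k + \<alpha> + 1" and "b = real (n - Suc k) + \<beta> + 1"
  have n: "real (n - k) = real (n - Suc k) + 1"
    using assms(5) by simp
  have "a > 0" "b > 0" "\<gamma> < a"
    using assms by (auto simp: a_def b_def)
  then have "beta_mean (a + 1) b g - beta_mean a (b + 1) g
       = q powr a / (1 - q powr (a + b + 1)) * beta_mean (a + 1) (b + 1) (q_diff g)"
    by (intro beta_mean_step[OF _ _ assms(1)])
  moreover have "q powr a = q ^ k * q powr (\<alpha> + 1)"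
    by (simp add: a_def add.assoc powr_add q_powr_real)
  moreover have "a + b + 1 = real n + \<alpha> + \<beta> + 2"
    using assms(5) by (simp add: a_def b_def)
  moreover have "a + 1 = real (Suc k) + \<alpha> + 1" "b + 1 = real (n - k) + \<beta> + 1"
    "a + 1 = real k + (\<alpha> + 1) + 1"
    by (simp_all add: a_def b_def n)
  ultimately show ?thesis
    by (simp add: a_def [symmetric] b_def [symmetric])
qed

lemma beta_mean_family_mono:
  assumes "growth_le \<gamma> g" "\<gamma> < \<alpha> + 1" "\<alpha> > -1" "\<beta> > -1" "k < n" "\<And>i. q_diff g i \<ge> 0"
  shows "beta_mean (real k + \<alpha> + 1) (real (n - k) + \<beta> + 1) g
    \<le> beta_mean (real (Suc k) + \<alpha> + 1) (real (n - Suc k) + \<beta> + 1) g"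
proof -
  have "q powr (real n + \<alpha> + \<beta> + 2) < 1"
    using assms by (intro q_powr_less_1) auto
  moreover have "beta_mean (real k + (\<alpha> + 1) + 1) (real (n - k) + \<beta> + 1) (q_diff g) \<ge> 0"
    using assms by (intro beta_mean_nonneg[OF growth_le_q_diff[OF assms(1)]]) auto
  ultimately have "q ^ k * (q powr (\<alpha> + 1) / (1 - q powr (real n + \<alpha> + \<beta> + 2)))
      * beta_mean (real k + (\<alpha> + 1) + 1) (real (n - k) + \<beta> + 1) (q_diff g) \<ge> 0"
    using q_pos by (intro mult_nonneg_nonneg divide_nonneg_nonneg) auto
  then show ?thesis
    using beta_mean_diff[OF assms(1-5)] by simp
qed

lemma q_durrmeyer_mono:
  assumes "\<alpha> > -1" "\<beta> > -1" "condition_C \<alpha> f" "mono_on {0<..<1} f"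
  shows "mono_on {0..1} (q_durrmeyer q \<alpha> \<beta> n f)"
proof -
  obtain \<gamma> where \<gamma>: "\<gamma> < \<alpha> + 1" "growth_le \<gamma> (\<lambda>i. f (node \<beta> i))"
    using growth_le_node[OF assms(3,2)] .
  have "q_diff (\<lambda>i. f (node \<beta> i)) i \<ge> 0" for i
    using mono_onD[OF assms(4), of "node \<beta> (Suc i)" "node \<beta> i"] q_pos
      node_pos node_less_1[OF assms(2)] node_Suc_less[of \<beta> i]
    by (simp add: q_diff_def less_imp_le)
  then have "mono_on {0..1} (bernstein_form n (\<lambda>k. q_durrmeyer_coeff q \<alpha> \<beta> n k f))"
    using beta_mean_family_mono[OF \<gamma>(2,1) assms(1,2)]
    by (intro bernstein_form_mono) (simp add: q_durrmeyer_coeff_eq_beta_mean)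
  then show ?thesis
    by (simp add: monotone_on_def q_durrmeyer_eq_bernstein_form)
qed

text \<open>
  The divided differences of the coefficients are means of $\partial g$ in the family for
  $\alpha + 1$, and they increase in $k$ because $\partial\partial g \ge 0$, which is
  the convexity of $f$ at three consecutive nodes.
\<close>

lemma q_durrmeyer_convex:
  assumes "\<alpha> > -1" "\<beta> > -1" "condition_C \<alpha> f" "convex_on {0<..<1} f"
  shows "convex_on {0..1} (q_durrmeyer q \<alpha> \<beta> n f)"
proof -
  define g where "g = (\<lambda>i. f (node \<beta> i))"
  define c where "c = (\<lambda>k. q_durrmeyer_coeff q \<alpha> \<beta> n k f)"
  define K where "K = q powr (\<alpha> + 1) / (1 - q powr (real n + \<alpha> + \<beta> + 2))"
  obtain \<gamma> where \<gamma>: "\<gamma> < \<alpha> + 1" "growth_le \<gamma> g"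
    using growth_le_node[OF assms(3,2)] unfolding g_def .
  have K: "K > 0"
    using q_powr_less_1[of "real n + \<alpha> + \<beta> + 2"] assms q_pos by (simp add: K_def)
  have D: "(c (Suc k) - c k) / q ^ k
      = K * beta_mean (real k + (\<alpha> + 1) + 1) (real (n - k) + \<beta> + 1) (q_diff g)" if "k < n" for k
    using beta_mean_diff[OF \<gamma>(2,1) assms(1,2) that] that q_pos
    by (simp add: c_def q_durrmeyer_coeff_eq_beta_mean g_def K_def)
  have "q_diff (q_diff g) i \<ge> 0" for i
  proof -
    define p where "p = node \<beta> i"
    have nodes: "node \<beta> (Suc i) = q * p" "node \<beta> (Suc (Suc i)) = q * (q * p)"
      by (simp_all add: p_def node_Suc)
    have "(g (Suc (Suc i)) - g (Suc i)) / (q * (q * p) - q * p) \<le> (g (Suc i) - g i) / (q * p - p)"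
    proof -
      have "node \<beta> j \<in> {0<..<1}" for j
        using node_pos node_less_1[OF assms(2)] by simp
      then have "(f (node \<beta> (Suc (Suc i))) - f (node \<beta> (Suc i))) / (node \<beta> (Suc (Suc i)) - node \<beta> (Suc i))
          \<le> (f (node \<beta> (Suc i)) - f (node \<beta> i)) / (node \<beta> (Suc i) - node \<beta> i)"
        by (intro order_trans[OF convex_on_slope_le(1,2)[OF assms(4)]] node_Suc_less)
      then show ?thesis
        by (simp only: g_def nodes p_def [symmetric])
    qed
    moreover have "(g (Suc (Suc i)) - g (Suc i)) / (q * (q * p) - q * p)
        = q ^ i / (p * (1 - q)) * q_diff g (Suc i)"
      using q_pos q_less_1 node_pos[of \<beta> i] by (simp add: p_def q_diff_def divide_simps) (simp add: algebra_simps)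
    moreover have "(g (Suc i) - g i) / (q * p - p) = q ^ i / (p * (1 - q)) * q_diff g i"
      using q_pos q_less_1 node_pos[of \<beta> i] by (simp add: p_def q_diff_def divide_simps) (simp add: algebra_simps)
    moreover have "q ^ i / (p * (1 - q)) > 0"
      using q_pos q_less_1 node_pos[of \<beta> i] by (simp add: p_def)
    ultimately have "q_diff g (Suc i) \<le> q_diff g i"
      by (simp only: mult_le_cancel_left_pos)
    then show ?thesis
      using q_pos by (simp add: q_diff_def[of "q_diff g"])
  qed
  then have "beta_mean (real k + (\<alpha> + 1) + 1) (real (n - k) + \<beta> + 1) (q_diff g)
      \<le> beta_mean (real (Suc k) + (\<alpha> + 1) + 1) (real (n - Suc k) + \<beta> + 1) (q_diff g)" if "k < n" for k
    using \<gamma> assms that by (intro beta_mean_family_mono[OF growth_le_q_diff[OF \<gamma>(2)]]) auto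
  then have "convex_on {0..1} (bernstein_form n c)"
    using K by (intro bernstein_form_convex) (simp only: D Suc_lessD mult_le_cancel_left_pos)
  moreover have "q_durrmeyer q \<alpha> \<beta> n f x = bernstein_form n c x" if "x \<in> {0..1}" for x
    unfolding c_def by (rule q_durrmeyer_eq_bernstein_form[OF that])
  moreover have "u *\<^sub>R x + v *\<^sub>R y \<in> {0..1}"
    if "x \<in> {0..1}" "y \<in> {0..1}" "0 \<le> u" "0 \<le> v" "u + v = 1" for x y u v :: real
    by (rule convexD[OF convex_real_interval(5) that])
  ultimately show ?thesis
    unfolding convex_on_def by metis
qed

text \<open>
  The case of a decreasing $f$ follows by passing to $-f$. Pulling the sign out of the infinite sums
  needs their convergence.
\<close>

lemma beta_mean_uminus:
  assumes "growth_le \<gamma> g" "\<gamma> < a" "b > 0"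
  shows "beta_mean a b (\<lambda>i. - g i) = - beta_mean a b g"
  using suminf_minus[OF summable_beta_weight_mult[OF assms(3,1,2)]]
  by (simp add: beta_mean_def beta_integral_def)

lemma q_durrmeyer_uminus:
  assumes "\<beta> > -1" "condition_C \<alpha> f"
  shows "q_durrmeyer q \<alpha> \<beta> n (\<lambda>x. - f x) x = - q_durrmeyer q \<alpha> \<beta> n f x"
proof -
  obtain \<gamma> where \<gamma>: "\<gamma> < \<alpha> + 1" "growth_le \<gamma> (\<lambda>i. f (node \<beta> i))"
    using growth_le_node[OF assms(2,1)] .
  have "q_durrmeyer_coeff q \<alpha> \<beta> n k (\<lambda>x. - f x) = - q_durrmeyer_coeff q \<alpha> \<beta> n k f" if "k \<le> n" for k
    unfolding q_durrmeyer_coeff_eq_beta_mean[OF that]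
    using \<gamma>(1) assms(1) that by (intro beta_mean_uminus[OF \<gamma>(2)]) auto
  then show ?thesis
    by (simp add: q_durrmeyer_def sum_negf)
qed

lemma condition_C_uminus: "condition_C \<alpha> f \<Longrightarrow> condition_C \<alpha> (\<lambda>x. - f x)"
  by (simp add: condition_C_def bounded_iff)

end

theorem corollary2:
  fixes q \<alpha> \<beta> :: real and n :: nat and f :: "real \<Rightarrow> real"
  assumes "0 < q" and "q < 1" and "\<alpha> > -1" and "\<beta> > -1"
    and "condition_C \<alpha> f"
  shows "(mono_on {0<..<1} f \<longrightarrow> mono_on {0..1} (q_durrmeyer q \<alpha> \<beta> n f)) \<and>
         (antimono_on {0<..<1} f \<longrightarrow> antimono_on {0..1} (q_durrmeyer q \<alpha> \<beta> n f)) \<and>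
         (convex_on {0<..<1} f \<longrightarrow> convex_on {0..1} (q_durrmeyer q \<alpha> \<beta> n f))"
proof -
  interpret q_parameter q
    using assms(1,2) by unfold_locales
  have "antimono_on {0..1} (q_durrmeyer q \<alpha> \<beta> n f)" if "antimono_on {0<..<1} f"
  proof -
    have "mono_on {0<..<1} (\<lambda>x. - f x)"
      using that by (simp add: monotone_on_def)
    then have "mono_on {0..1} (q_durrmeyer q \<alpha> \<beta> n (\<lambda>x. - f x))"
      by (rule q_durrmeyer_mono[OF assms(3,4) condition_C_uminus[OF assms(5)]])
    then show ?thesis
      by (simp add: monotone_on_def q_durrmeyer_uminus[OF assms(4,5)])
  qed
  then show ?thesis
    using q_durrmeyer_mono[OF assms(3,4,5)] q_durrmeyer_convex[OF assms(3,4,5)] by blast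
qed

end
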